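(* Let $G(p)$ be a bar framework on $n$ nodes in general position in $\mathbb{R}^r$, for some $r \leq n-2$. If there exists a positive semidefinite stress matrix $S$ of $G(p)$ of rank $n-r-1$, then $G(p)$ is universally rigid.
   Context: Throughout, $G$ is a simple graph on vertices $V(G)=\{1,\ldots,n\}$ with edge set $E(G)$, assumed connected and not complete. A configuration $p$ in $\mathbb{R}^r$ is a finite collection of points $(p^1,\ldots,p^n)$ in $\mathbb{R}^r$ that affinely span $\mathbb{R}^r$. A bar framework (framework) $G(p)$ in $\mathbb{R}^r$ is a configuration $p=(p^1,\ldots,p^n)$ in $\mathbb{R}^r$ together with such a graph $G$. General position: $G(p)$ (or $p$) in $\mathbb{R}^r$ is in general position if no subset of the points $p^1,\ldots,p^n$ of cardinality $r+1$ is affinely dependent. Stress matrix: an equilibrium stress of $G(p)$ is a real-valued function $\omega$ on $E(G)$ (with $\omega_{ij}=\omega_{ji}$) such that $\sum_{j:(i,j)\in E(G)}\omega_{ij}(p^i-p^j)=0$ for all $i=1,\ldots,n$. The stress matrix associated with $\omega$ (a stress matrix of $G(p)$) is the $n\times n$ symmetric matrix $S=(s_{ij})$ with $s_{ij}=-\omega_{ij}$ if $(i,j)\in E(G)$, $s_{ij}=0$ if $i\neq j$ and $(i,j)\notin E(G)$, and $s_{ii}=\sum_{k:(i,k)\in E(G)}\omega_{ik}$. Universal rigidity: a framework $G(q)$ in $\mathbb{R}^s$ (same graph $G$) is equivalent to $G(p)$ if $\|q^i-q^j\|=\|p^i-p^j\|$ for all $(i,j)\in E(G)$, and congruent to $G(p)$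 if $\|q^i-q^j\|=\|p^i-p^j\|$ for all $i,j=1,\ldots,n$ (Euclidean norms). $G(p)$ is universally rigid if there does not exist a framework $G(q)$ in any Euclidean space (of any dimension $s$) that is equivalent, but not congruent, to $G(p)$. *)

theory Defs
  imports "HOL-Analysis.Analysis"
begin

text \<open>
  The nodes are the elements of a finite type \<open>'n\<close>, so the number of nodes is \<open>CARD('n)\<close>.
  Universal rigidity quantifies over the dimension of the ambient space, so the dimension has to
  be a term and not a type. A point of the Euclidean space of dimension \<open>r\<close> is a sequence
  \<open>x :: nat \<Rightarrow> real\<close> with \<open>x k = 0\<close> for all \<open>k \<ge> r\<close>, that is, an element of
  \<open>topspace (Euclidean_space r)\<close>. As \<open>nat \<Rightarrow> real\<close> is not an instance of
  \<open>real_vector\<close>, the affine notions are spelled out coordinatewise. They refer to families of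
  points indexed by nodes: two coinciding points with different indices are affinely dependent.
\<close>

definition simple_graph :: "('n \<times> 'n) set \<Rightarrow> bool" where
  "simple_graph E \<longleftrightarrow> sym E \<and> irrefl E"

definition connected_graph :: "('n \<times> 'n) set \<Rightarrow> bool" where
  "connected_graph E \<longleftrightarrow> (\<forall>i j. (i, j) \<in> E\<^sup>*)"

definition complete_graph :: "('n \<times> 'n) set \<Rightarrow> bool" where
  "complete_graph E \<longleftrightarrow> (\<forall>i j. i \<noteq> j \<longrightarrow> (i, j) \<in> E)"

definition euclidean_dist :: "nat \<Rightarrow> (nat \<Rightarrow> real) \<Rightarrow> (nat \<Rightarrow> real) \<Rightarrow> real" where
  "euclidean_dist r x y = L2_set (\<lambda>k. x k - y k) {..<r}"

definition affinely_spanning :: "nat \<Rightarrow> ('n::finite \<Rightarrow> nat \<Rightarrow> real) \<Rightarrow> bool" where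
  "affinely_spanning r p \<longleftrightarrow>
     (\<forall>x \<in> topspace (Euclidean_space r).
        \<exists>c. (\<Sum>i\<in>UNIV. c i) = 1 \<and> (\<forall>k<r. x k = (\<Sum>i\<in>UNIV. c i * p i k)))"

definition affinely_dependent :: "nat \<Rightarrow> ('n \<Rightarrow> nat \<Rightarrow> real) \<Rightarrow> 'n set \<Rightarrow> bool" where
  "affinely_dependent r p I \<longleftrightarrow>
     (\<exists>c. (\<Sum>i\<in>I. c i) = 0 \<and> (\<exists>i\<in>I. c i \<noteq> 0) \<and> (\<forall>k<r. (\<Sum>i\<in>I. c i * p i k) = 0))"

definition configuration :: "nat \<Rightarrow> ('n::finite \<Rightarrow> nat \<Rightarrow> real) \<Rightarrow> bool" where
  "configuration r p \<longleftrightarrow> range p \<subseteq> topspace (Euclidean_space r) \<and> affinely_spanning r p"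

definition bar_framework :: "('n \<times> 'n) set \<Rightarrow> nat \<Rightarrow> ('n::finite \<Rightarrow> nat \<Rightarrow> real) \<Rightarrow> bool" where
  "bar_framework E r p \<longleftrightarrow>
     simple_graph E \<and> connected_graph E \<and> \<not> complete_graph E \<and> configuration r p"

definition general_position :: "nat \<Rightarrow> ('n::finite \<Rightarrow> nat \<Rightarrow> real) \<Rightarrow> bool" where
  "general_position r p \<longleftrightarrow> (\<forall>I. card I = r + 1 \<longrightarrow> \<not> affinely_dependent r p I)"

text \<open>A stress is a total function of which only the values on \<open>E\<close> are relevant.\<close>

definition equilibrium_stress ::
  "('n \<times> 'n) set \<Rightarrow> nat \<Rightarrow> ('n::finite \<Rightarrow> nat \<Rightarrow> real) \<Rightarrow> ('n \<Rightarrow> 'n \<Rightarrow> real) \<Rightarrow> bool" where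
  "equilibrium_stress E r p \<omega> \<longleftrightarrow>
     (\<forall>(i, j) \<in> E. \<omega> i j = \<omega> j i) \<and>
     (\<forall>i. \<forall>k<r. (\<Sum>j | (i, j) \<in> E. \<omega> i j * (p i k - p j k)) = 0)"

definition associated_matrix :: "('n \<times> 'n) set \<Rightarrow> ('n::finite \<Rightarrow> 'n \<Rightarrow> real) \<Rightarrow> real^'n^'n" where
  "associated_matrix E \<omega> =
     (\<chi> i j. if i = j then \<Sum>k | (i, k) \<in> E. \<omega> i k
            else if (i, j) \<in> E then - \<omega> i j
            else 0)"

definition stress_matrix ::
  "('n \<times> 'n) set \<Rightarrow> nat \<Rightarrow> ('n::finite \<Rightarrow> nat \<Rightarrow> real) \<Rightarrow> real^'n^'n \<Rightarrow> bool" where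
  "stress_matrix E r p S \<longleftrightarrow> (\<exists>\<omega>. equilibrium_stress E r p \<omega> \<and> S = associated_matrix E \<omega>)"

definition positive_semidefinite :: "real^'n^'n \<Rightarrow> bool" where
  "positive_semidefinite A \<longleftrightarrow> transpose A = A \<and> (\<forall>x. 0 \<le> x \<bullet> (A *v x))"

definition equivalent_frameworks ::
  "('n \<times> 'n) set \<Rightarrow> nat \<Rightarrow> ('n \<Rightarrow> nat \<Rightarrow> real) \<Rightarrow> nat \<Rightarrow> ('n \<Rightarrow> nat \<Rightarrow> real) \<Rightarrow> bool" where
  "equivalent_frameworks E s q r p \<longleftrightarrow>
     (\<forall>(i, j) \<in> E. euclidean_dist s (q i) (q j) = euclidean_dist r (p i) (p j))"

definition congruent_frameworks ::
  "nat \<Rightarrow> ('n \<Rightarrow> nat \<Rightarrow> real) \<Rightarrow> nat \<Rightarrow> ('n \<Rightarrow> nat \<Rightarrow> real) \<Rightarrow> bool" where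
  "congruent_frameworks s q r p \<longleftrightarrow>
     (\<forall>i j. euclidean_dist s (q i) (q j) = euclidean_dist r (p i) (p j))"

definition universally_rigid :: "('n \<times> 'n) set \<Rightarrow> nat \<Rightarrow> ('n::finite \<Rightarrow> nat \<Rightarrow> real) \<Rightarrow> bool" where
  "universally_rigid E r p \<longleftrightarrow>
     \<not> (\<exists>s q. bar_framework E s q \<and> equivalent_frameworks E s q r p
              \<and> \<not> congruent_frameworks s q r p)"

end

theory Submission
  imports Defs
begin

text \<open>
  Let \<open>G(q)\<close> be equivalent to \<open>G(p)\<close>, and let \<open>D\<close> be the matrix of the differences
  \<open>\<parallel>q\<^sup>i - q\<^sup>j\<parallel>\<^sup>2 - \<parallel>p\<^sup>i - p\<^sup>j\<parallel>\<^sup>2\<close>; congruence means \<open>D = 0\<close>. Three facts about the stress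
  matrix \<open>S\<close> force this.

  Energy. As \<open>S\<close> has row sums zero, \<open>\<Sum>ij. S\<^sub>ij \<parallel>q\<^sup>i - q\<^sup>j\<parallel>\<^sup>2\<close> is \<open>-2\<close> times the sum of the values
  of the quadratic form \<open>S\<close> at the coordinate vectors of \<open>q\<close>. The sum only sees edge lengths, so it
  equals the one for \<open>p\<close>, which vanishes. By semidefiniteness every coordinate vector of \<open>q\<close> lies
  in the kernel of \<open>S\<close> (\<open>equivalent_coordinates_in_kernel\<close>).

  Orthogonality. Since the coordinates of \<open>p\<close> and \<open>q\<close> lie in the kernel of \<open>S\<close>, expanding the
  squares shows that the \<open>k\<close>-th entry of \<open>S D\<^sub>i\<close>, where \<open>D\<^sub>i\<close> is the \<open>i\<close>-th row of \<open>D\<close>, does not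
  depend on \<open>i\<close>. For \<open>i = k\<close> it is zero: \<open>D\<close> vanishes on the edges and the diagonal, and \<open>S\<close>
  vanishes everywhere else. Hence all rows of \<open>D\<close> lie in the kernel of \<open>S\<close>.

  General position. The kernel of \<open>S\<close> has dimension \<open>r + 1\<close>, so it consists of the affine functions
  of the points of \<open>p\<close>, and such a function is zero once it vanishes at \<open>r + 1\<close> nodes
  (\<open>kernel_vector_determined\<close>). The row \<open>D\<^sub>i\<close> vanishes on the support of the \<open>i\<close>-th row of \<open>S\<close>.
  That support has more than \<open>r + 1\<close> elements (\<open>stress_row_support\<close>), because the entries of the row
  are the coefficients of an affine dependence. So \<open>D\<^sub>i = 0\<close> for each \<open>i\<close>.
\<close>

section \<open>Quadratic forms and kernels of symmetric matrices\<close>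

text \<open>
  Moving from \<open>x\<close> by a small multiple of \<open>- A x\<close> changes the value of the form to first
  order by a negative multiple of \<open>\<parallel>A x\<parallel>\<^sup>2\<close>, so a minimiser of the form lies in the kernel.
\<close>

lemma psd_form_zero_imp_kernel:
  fixes A :: "real^'n^'n"
  assumes psd: "positive_semidefinite A" and zero: "x \<bullet> (A *v x) = 0"
  shows "A *v x = 0"
proof (rule ccontr)
  assume "A *v x \<noteq> 0"
  define y where "y = A *v x"
  define a where "a = y \<bullet> y"
  define b where "b = y \<bullet> (A *v y)"
  have "a > 0"
    using \<open>A *v x \<noteq> 0\<close> by (simp add: a_def y_def)
  have "b \<ge> 0"
    using psd by (simp add: positive_semidefinite_def b_def)
  have "transpose A = A"
    using psd by (simp add: positive_semidefinite_def)
  then have xy: "x \<bullet> (A *v y) = a"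
    by (metis a_def y_def dot_lmul_matrix vector_transpose_matrix)
  \<comment> \<open>The minimiser of \<open>t\<^sup>2 * b - 2 * t * a\<close> is \<open>a / b\<close>; the denominator \<open>b + 1\<close> covers \<open>b = 0\<close>.\<close>
  define t where "t = a / (b + 1)"
  have "0 \<le> (x - t *\<^sub>R y) \<bullet> (A *v (x - t *\<^sub>R y))"
    using psd by (simp add: positive_semidefinite_def)
  also have "\<dots> = t\<^sup>2 * b - 2 * t * a"
    using zero xy
    by (simp add: matrix_vector_mult_diff_distrib matrix_vector_mult_scaleR inner_diff_left
        inner_diff_right power2_eq_square flip: y_def a_def b_def) (simp add: algebra_simps)
  also have "\<dots> = t * (t * b - 2 * a)"
    by (simp add: power2_eq_square algebra_simps)
  finally have "0 \<le> t * (t * b - 2 * a)" .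
  moreover have "t > 0"
    using \<open>a > 0\<close> \<open>b \<ge> 0\<close> by (simp add: t_def)
  ultimately have "2 * a \<le> t * b"
    by (simp add: zero_le_mult_iff)
  also have "\<dots> \<le> a"
    using \<open>a > 0\<close> \<open>b \<ge> 0\<close> by (simp add: t_def field_simps)
  finally show False
    using \<open>a > 0\<close> by simp
qed

text \<open>
  Expanding the square leaves only the mixed terms: the pure squares are multiplied by row and
  column sums of \<open>A\<close>, which are zero.
\<close>

lemma weighted_square_differences_form:
  fixes A :: "real^'n^'n"
  assumes sym: "transpose A = A" and one: "A *v 1 = 0"
  shows "(\<Sum>i\<in>UNIV. \<Sum>j\<in>UNIV. A $ i $ j * (x $ i - x $ j)\<^sup>2) = - 2 * (x \<bullet> (A *v x))"
proof -
  have row: "(\<Sum>j\<in>UNIV. A $ i $ j) = 0" for i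
    using one by (simp add: matrix_vector_mult_def vec_eq_iff)
  have sym': "A $ i $ j = A $ j $ i" for i j
    using sym by (metis transpose_def vec_lambda_beta)
  have col: "(\<Sum>i\<in>UNIV. A $ i $ j) = 0" for j
    using row[of j] by (subst sym') simp
  have "(\<Sum>i\<in>UNIV. \<Sum>j\<in>UNIV. A $ i $ j * (x $ i - x $ j)\<^sup>2)
      = (\<Sum>i\<in>UNIV. \<Sum>j\<in>UNIV. A $ i $ j * (x $ i)\<^sup>2)
        + (\<Sum>i\<in>UNIV. \<Sum>j\<in>UNIV. A $ i $ j * (x $ j)\<^sup>2)
        - (\<Sum>i\<in>UNIV. \<Sum>j\<in>UNIV. 2 * (x $ i * (A $ i $ j * x $ j)))"
    unfolding sum.distrib[symmetric] sum_subtractf[symmetric]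
    by (intro sum.cong refl) (simp add: power2_eq_square algebra_simps)
  also have "(\<Sum>i\<in>UNIV. \<Sum>j\<in>UNIV. A $ i $ j * (x $ i)\<^sup>2) = 0"
    using row by (simp flip: sum_distrib_right)
  also have "(\<Sum>i\<in>UNIV. \<Sum>j\<in>UNIV. A $ i $ j * (x $ j)\<^sup>2) = 0"
    using col by (subst sum.swap) (simp flip: sum_distrib_right)
  also have "(\<Sum>i\<in>UNIV. \<Sum>j\<in>UNIV. 2 * (x $ i * (A $ i $ j * x $ j))) = 2 * (x \<bullet> (A *v x))"
    by (simp add: inner_vec_def matrix_vector_mult_def sum_distrib_left)
  finally show ?thesis
    by simp
qed

text \<open>
  For \<open>x\<close> in the kernel, only the term \<open>(x $ j)\<^sup>2\<close> of \<open>(c - x $ j)\<^sup>2\<close> survives; the value is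
  thus independent of \<open>c\<close>.
\<close>

lemma weighted_square_differences_const:
  fixes A :: "real^'n^'n"
  assumes one: "A *v 1 = 0" and x: "A *v x = 0"
  shows "(\<Sum>j\<in>UNIV. A $ k $ j * (c - x $ j)\<^sup>2) = (\<Sum>j\<in>UNIV. A $ k $ j * (x $ j)\<^sup>2)"
proof -
  have row: "(\<Sum>j\<in>UNIV. A $ k $ j) = 0" "(\<Sum>j\<in>UNIV. A $ k $ j * x $ j) = 0"
    using one x by (simp_all add: matrix_vector_mult_def vec_eq_iff)
  have "(\<Sum>j\<in>UNIV. A $ k $ j * (c - x $ j)\<^sup>2)
      = (\<Sum>j\<in>UNIV. c\<^sup>2 * A $ k $ j - 2 * c * (A $ k $ j * x $ j) + A $ k $ j * (x $ j)\<^sup>2)"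
    by (intro sum.cong refl) (simp add: power2_eq_square algebra_simps)
  also have "\<dots> = (\<Sum>j\<in>UNIV. A $ k $ j * (x $ j)\<^sup>2)"
    using row by (simp add: sum.distrib sum_subtractf flip: sum_distrib_left)
  finally show ?thesis .
qed

section \<open>Stress matrices\<close>

definition coordinate_vector :: "('n \<Rightarrow> nat \<Rightarrow> real) \<Rightarrow> nat \<Rightarrow> real^'n" where
  "coordinate_vector p k = (\<chi> i. p i k)"

lemma coordinate_vector_nth [simp]: "coordinate_vector p k $ i = p i k"
  by (simp add: coordinate_vector_def)

lemma euclidean_dist_power2: "(euclidean_dist r x y)\<^sup>2 = (\<Sum>k<r. (x k - y k)\<^sup>2)"
  by (simp add: euclidean_dist_def L2_set_def sum_nonneg)

lemma associated_matrix_mult: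
  fixes E :: "('n::finite \<times> 'n) set"
  assumes "simple_graph E"
  shows "(associated_matrix E \<omega> *v x) $ i = (\<Sum>j | (i, j) \<in> E. \<omega> i j * (x $ i - x $ j))"
proof -
  have irr: "(i, i) \<notin> E"
    using assms by (auto simp: simple_graph_def irrefl_def)
  have "(associated_matrix E \<omega> *v x) $ i
      = (\<Sum>j\<in>UNIV. (if j = i then (\<Sum>k | (i, k) \<in> E. \<omega> i k) * x $ i else 0)
                   - (if (i, j) \<in> E then \<omega> i j * x $ j else 0))"
    unfolding matrix_vector_mult_def associated_matrix_def vec_lambda_beta
    using irr by (intro sum.cong refl) auto
  also have "\<dots> = (\<Sum>k | (i, k) \<in> E. \<omega> i k) * x $ i - (\<Sum>j | (i, j) \<in> E. \<omega> i j * x $ j)"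
    by (simp add: sum_subtractf sum.If_cases)
  also have "\<dots> = (\<Sum>j | (i, j) \<in> E. \<omega> i j * (x $ i - x $ j))"
    by (simp add: right_diff_distrib sum_subtractf sum_distrib_right)
  finally show ?thesis .
qed

lemma stress_matrix_kernel:
  fixes E :: "('n::finite \<times> 'n) set"
  assumes "simple_graph E" "stress_matrix E r p S"
  shows "S *v 1 = 0" "k < r \<Longrightarrow> S *v coordinate_vector p k = 0"
proof -
  obtain \<omega> where \<omega>: "equilibrium_stress E r p \<omega>" and S: "S = associated_matrix E \<omega>"
    using assms(2) by (auto simp: stress_matrix_def)
  show "S *v 1 = 0"
    unfolding S vec_eq_iff associated_matrix_mult[OF assms(1)] by simp
  show "S *v coordinate_vector p k = 0" if "k < r"
    using \<omega> that unfolding S vec_eq_iff associated_matrix_mult[OF assms(1)]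
    by (simp add: equilibrium_stress_def)
qed

lemma stress_matrix_nonedge:
  assumes "stress_matrix E r p S" "i \<noteq> j" "(i, j) \<notin> E"
  shows "S $ i $ j = 0"
  using assms by (auto simp: stress_matrix_def associated_matrix_def)

text \<open>
  Where \<open>S\<close> has a nonzero entry, the two distances agree: the pair is an edge, or both are zero.
\<close>

lemma stress_times_square_length:
  assumes stress: "stress_matrix E r p S" and equiv: "equivalent_frameworks E s q r p"
  shows "S $ i $ j * (euclidean_dist s (q i) (q j))\<^sup>2
    = S $ i $ j * (euclidean_dist r (p i) (p j))\<^sup>2"
proof (cases "(i, j) \<in> E")
  case True
  then have "euclidean_dist s (q i) (q j) = euclidean_dist r (p i) (p j)"
    using equiv by (auto simp: equivalent_frameworks_def)
  then show ?thesis
    by simp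
next
  case False
  then show ?thesis
    using stress_matrix_nonedge[OF stress, of i j]
    by (cases "i = j") (auto simp: euclidean_dist_power2)
qed

lemma kernel_orthogonal_range:
  fixes S :: "real^'n^'n"
  assumes "transpose S = S" "S *v u = 0"
  shows "u \<bullet> (S *v x) = 0"
  using assms by (metis dot_lmul_matrix inner_zero_left vector_transpose_matrix)

text \<open>
  A vector in the range of \<open>S\<close> is orthogonal to \<open>1\<close> and to the coordinates of \<open>p\<close>, so its entries
  are the coefficients of an affine dependence among the points of \<open>p\<close>.
\<close>

lemma range_vector_small_support:
  fixes S :: "real^'n^'n" and p :: "'n \<Rightarrow> nat \<Rightarrow> real"
  assumes gp: "general_position r p"
    and sym: "transpose S = S"
    and one: "S *v 1 = 0"
    and coord: "\<And>k. k < r \<Longrightarrow> S *v coordinate_vector p k = 0"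
    and I: "card I = r + 1"
    and supp: "\<And>i. i \<notin> I \<Longrightarrow> (S *v x) $ i = 0"
  shows "S *v x = 0"
proof -
  define c where "c = S *v x"
  have restrict: "(\<Sum>i\<in>I. c $ i * f i) = (\<Sum>i\<in>UNIV. c $ i * f i)" for f
    using supp by (intro sum.mono_neutral_left) (auto simp: c_def)
  have "(\<Sum>i\<in>I. c $ i) = 0"
    using kernel_orthogonal_range[OF sym one, of x] restrict[of "\<lambda>_. 1"]
    by (simp add: inner_vec_def c_def)
  moreover have "(\<Sum>i\<in>I. c $ i * p i k) = 0" if "k < r" for k
    using kernel_orthogonal_range[OF sym coord[OF that], of x] restrict[of "\<lambda>i. p i k"]
    by (simp add: inner_vec_def c_def mult.commute)
  moreover have "\<not> affinely_dependent r p I"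
    using gp I by (simp add: general_position_def)
  ultimately have "\<forall>i\<in>I. c $ i = 0"
    unfolding affinely_dependent_def by blast
  then show ?thesis
    using supp by (auto simp: vec_eq_iff c_def)
qed

text \<open>
  By the previous lemma, the range of \<open>S\<close> and the space of vectors supported on \<open>I\<close> intersect
  trivially. Their dimensions add up to the number of nodes, so together they span the whole space.
  A kernel vector that vanishes on \<open>I\<close> is orthogonal to both.
\<close>

lemma kernel_vector_determined:
  fixes S :: "real^'n^'n" and p :: "'n \<Rightarrow> nat \<Rightarrow> real"
  assumes gp: "general_position r p"
    and sym: "transpose S = S"
    and one: "S *v 1 = 0"
    and coord: "\<And>k. k < r \<Longrightarrow> S *v coordinate_vector p k = 0"
    and rank: "rank S = CARD('n) - r - 1"
    and I: "card I = r + 1"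
    and x: "S *v x = 0" "\<And>i. i \<in> I \<Longrightarrow> x $ i = 0"
  shows "x = 0"
proof -
  define W where "W = range (\<lambda>y. S *v y)"
  define F where "F = {y :: real^'n. \<forall>i. i \<notin> I \<longrightarrow> y $ i = 0}"
  have card: "r + 1 \<le> CARD('n)"
    using card_mono[of UNIV I] I by simp
  have sub: "subspace W" "subspace F"
    unfolding W_def F_def
    by (auto intro!: linear_subspace_image) (auto simp: subspace_def)
  have "dim W = CARD('n) - r - 1"
    using rank by (simp add: rank_dim_range W_def)
  moreover have "dim F = r + 1"
    using dim_substandard_cart[of I, where 'a = real] I by (simp add: F_def dim_vec_eq)
  moreover have "W \<inter> F \<subseteq> {0}"
    using range_vector_small_support[OF gp sym one coord I] by (auto simp: W_def F_def)
  then have "dim (W \<inter> F) = 0"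
    by simp
  ultimately have "dim {a + b | a b. a \<in> W \<and> b \<in> F} = CARD('n)"
    using dim_sums_Int[OF sub] card by linarith
  then have "dim {a + b | a b. a \<in> W \<and> b \<in> F} = DIM(real^'n)"
    by simp
  then have "{a + b | a b. a \<in> W \<and> b \<in> F} = UNIV"
    using subspace_sums[OF sub] by (simp only: dim_eq_full span_eq_iff[THEN iffD2])
  then obtain a b where ab: "x = a + b" "a \<in> W" "b \<in> F"
    by blast
  have "x \<bullet> a = 0"
    using ab(2) kernel_orthogonal_range[OF sym x(1)] by (auto simp: W_def)
  moreover have "x \<bullet> b = 0"
    using ab(3) x(2) unfolding inner_vec_def F_def by (intro sum.neutral) fastforce
  ultimately have "x \<bullet> x = 0"
    by (metis ab(1) add_0 inner_add_right)
  then show ?thesis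
    by simp
qed

text \<open>
  A row with at most \<open>r + 1\<close> nonzero entries would be zero. Then the corresponding
  standard basis vector would be in the kernel, although it vanishes at the other \<open>n - 1 \<ge> r + 1\<close>
  nodes.
\<close>

lemma stress_row_support:
  fixes S :: "real^'n^'n" and p :: "'n \<Rightarrow> nat \<Rightarrow> real"
  assumes gp: "general_position r p"
    and sym: "transpose S = S"
    and one: "S *v 1 = 0"
    and coord: "\<And>k. k < r \<Longrightarrow> S *v coordinate_vector p k = 0"
    and rank: "rank S = CARD('n) - r - 1"
    and n: "r + 2 \<le> CARD('n)"
  shows "r + 1 < card {j. S $ i $ j \<noteq> 0}"
proof (rule ccontr)
  assume "\<not> r + 1 < card {j. S $ i $ j \<noteq> 0}"
  then obtain I where I: "{j. S $ i $ j \<noteq> 0} \<subseteq> I" "card I = r + 1"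
    using exists_subset_between[of "{j. S $ i $ j \<noteq> 0}" "r + 1" UNIV] n by auto
  have col: "(S *v axis i 1) $ j = S $ i $ j" for j
    using sym by (metis matrix_vector_mult_basis row_def row_transpose vec_lambda_eta)
  have kernel: "S *v axis i 1 = 0"
    by (rule range_vector_small_support[OF gp sym one coord I(2)]) (use I(1) col in auto)
  have "r + 1 \<le> card (UNIV - {i})"
    using n by (simp add: card_Diff_singleton)
  then obtain J where J: "J \<subseteq> UNIV - {i}" "card J = r + 1"
    by (meson obtain_subset_with_card_n)
  have "(axis i 1 :: real^'n) = 0"
    by (rule kernel_vector_determined[OF gp sym one coord rank J(2) kernel])
      (use J(1) in \<open>auto simp: axis_def\<close>)
  then show False
    by simp
qed

section \<open>Universal rigidity\<close>

text \<open>
  The total stress energy depends only on edge lengths. It is a sum of nonnegative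
  contributions of the coordinates, and it is zero for \<open>p\<close>.
\<close>

lemma equivalent_coordinates_in_kernel:
  fixes E :: "('n::finite \<times> 'n) set"
  assumes graph: "simple_graph E"
    and stress: "stress_matrix E r p S"
    and psd: "positive_semidefinite S"
    and equiv: "equivalent_frameworks E s q r p"
    and "k < s"
  shows "S *v coordinate_vector q k = 0"
proof -
  have sym: "transpose S = S"
    using psd by (simp add: positive_semidefinite_def)
  note one = stress_matrix_kernel(1)[OF graph stress]
  have energy: "(\<Sum>i\<in>UNIV. \<Sum>j\<in>UNIV. S $ i $ j * (euclidean_dist m (x i) (x j))\<^sup>2)
      = - 2 * (\<Sum>k<m. coordinate_vector x k \<bullet> (S *v coordinate_vector x k))" for m x
  proof -
    have "(\<Sum>i\<in>UNIV. \<Sum>j\<in>UNIV. S $ i $ j * (euclidean_dist m (x i) (x j))\<^sup>2)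
        = (\<Sum>i\<in>UNIV. \<Sum>k<m. \<Sum>j\<in>UNIV. S $ i $ j * (x i k - x j k)\<^sup>2)"
      unfolding euclidean_dist_power2 sum_distrib_left
      by (intro sum.cong refl sum.swap)
    also have "\<dots> = (\<Sum>k<m. \<Sum>i\<in>UNIV. \<Sum>j\<in>UNIV. S $ i $ j * (x i k - x j k)\<^sup>2)"
      by (rule sum.swap)
    also have "\<dots> = (\<Sum>k<m. - 2 * (coordinate_vector x k \<bullet> (S *v coordinate_vector x k)))"
      using weighted_square_differences_form[OF sym one, of "coordinate_vector x _"] by simp
    finally show ?thesis
      by (simp add: sum_distrib_left)
  qed
  have "- 2 * (\<Sum>k<s. coordinate_vector q k \<bullet> (S *v coordinate_vector q k))
      = - 2 * (\<Sum>k<r. coordinate_vector p k \<bullet> (S *v coordinate_vector p k))"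
    by (simp only: energy[symmetric] stress_times_square_length[OF stress equiv])
  also have "\<dots> = 0"
    using stress_matrix_kernel(2)[OF graph stress] by simp
  finally have "(\<Sum>k<s. coordinate_vector q k \<bullet> (S *v coordinate_vector q k)) = 0"
    by simp
  then have "coordinate_vector q k \<bullet> (S *v coordinate_vector q k) = 0"
    using psd \<open>k < s\<close> by (subst (asm) sum_nonneg_eq_0_iff) (auto simp: positive_semidefinite_def)
  then show ?thesis
    by (rule psd_form_zero_imp_kernel[OF psd])
qed

theorem theorem1p4:
  fixes E :: "('n::finite \<times> 'n) set"
    and p :: "'n \<Rightarrow> nat \<Rightarrow> real"
    and r :: nat
  assumes "bar_framework E r p"
    and "general_position r p"
    and "r + 2 \<le> CARD('n)"
    and "\<exists>S. stress_matrix E r p S \<and> positive_semidefinite S \<and> rank S = CARD('n) - r - 1"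
  shows "universally_rigid E r p"
proof -
  obtain S where stress: "stress_matrix E r p S" and psd: "positive_semidefinite S"
    and rank: "rank S = CARD('n) - r - 1"
    using assms(4) by blast
  have graph: "simple_graph E"
    using assms(1) by (simp add: bar_framework_def)
  have sym: "transpose S = S"
    using psd by (simp add: positive_semidefinite_def)
  note one = stress_matrix_kernel(1)[OF graph stress]
    and coord = stress_matrix_kernel(2)[OF graph stress]
  have "congruent_frameworks s q r p" if equiv: "equivalent_frameworks E s q r p" for s q
  proof -
    define D where
      "D i = (\<chi> j. (euclidean_dist s (q i) (q j))\<^sup>2 - (euclidean_dist r (p i) (p j))\<^sup>2)" for i
    note qcoord = equivalent_coordinates_in_kernel[OF graph stress psd equiv]
    have SD: "S $ i $ j * D i $ j = 0" for i j
      using stress_times_square_length[OF stress equiv] by (simp add: D_def right_diff_distrib)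
    have dist_const: "(\<Sum>j\<in>UNIV. S $ k $ j * (euclidean_dist m (x i) (x j))\<^sup>2)
        = (\<Sum>l<m. \<Sum>j\<in>UNIV. S $ k $ j * (x j l)\<^sup>2)"
      if "\<And>l. l < m \<Longrightarrow> S *v coordinate_vector x l = 0" for m x i k
    proof -
      have "(\<Sum>j\<in>UNIV. S $ k $ j * (euclidean_dist m (x i) (x j))\<^sup>2)
          = (\<Sum>l<m. \<Sum>j\<in>UNIV. S $ k $ j * (x i l - x j l)\<^sup>2)"
        unfolding euclidean_dist_power2 sum_distrib_left by (rule sum.swap)
      also have "\<dots> = (\<Sum>l<m. \<Sum>j\<in>UNIV. S $ k $ j * (x j l)\<^sup>2)"
        using weighted_square_differences_const[OF one that] by simp
      finally show ?thesis .
    qed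
    have "(S *v D i) $ k = (S *v D k) $ k" for i k
      using dist_const[OF qcoord] dist_const[OF coord]
      by (simp add: matrix_vector_mult_def D_def right_diff_distrib sum_subtractf)
    moreover have "(S *v D k) $ k = 0" for k
      by (simp only: matrix_vector_mult_def vec_lambda_beta SD sum.neutral_const)
    ultimately have kernel: "S *v D i = 0" for i
      by (simp add: vec_eq_iff)
    have "D i = 0" for i
    proof -
      obtain I where I: "I \<subseteq> {j. S $ i $ j \<noteq> 0}" "card I = r + 1"
        using stress_row_support[OF assms(2) sym one coord rank assms(3), of i]
        by (meson less_imp_le obtain_subset_with_card_n)
      show ?thesis
        by (rule kernel_vector_determined[OF assms(2) sym one coord rank I(2) kernel])
          (use I(1) SD in auto)
    qed
    then have "(euclidean_dist s (q i) (q j))\<^sup>2 = (euclidean_dist r (p i) (p j))\<^sup>2" for i j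
      by (simp add: D_def vec_eq_iff)
    then show ?thesis
      by (simp add: congruent_frameworks_def euclidean_dist_def L2_set_nonneg)
  qed
  then show ?thesis
    unfolding universally_rigid_def by blast
qed

end
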